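(* Let $m$ and $n$ be integers with $m\ge n\ge1$, and let $\ell$ be a vector with $m$ real elements $\ell_j$ that satisfy $0\le\ell_j\le1$ for $1\le j\le m$ and $\sum_{j=1}^m\ell_j=n$. Then there exists a real $m\times n$ matrix $Q$ with orthonormal columns that has leverage scores $\|e_j^TQ\|_2^2=\ell_j$, $1\le j\le m$, and coherence $\mu=\max_{1\le j\le m}\ell_j$.
   Context: Here $e_1,\dots,e_m$ are the canonical (column) basis vectors of $\mathbb{R}^m$ and $\|\cdot\|_2$ is the Euclidean two-norm. For a real $m\times n$ matrix $Q$ with $Q^TQ=I_n$, the leverage scores are the squared row norms $\|e_j^TQ\|_2^2$, $1\le j\le m$, and the coherence is $\mu\equiv\max_{1\le j\le m}\|e_j^TQ\|_2^2$. *)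

theory Defs
  imports "HOL-Analysis.Analysis"
begin

text \<open>An \<open>m \<times> n\<close> real matrix is a \<open>real ^ 'n ^ 'm\<close> with
  \<open>m = CARD('m)\<close> and \<open>n = CARD('n)\<close>; finite types are nonempty, so \<open>n \<ge> 1\<close>
  holds automatically.\<close>

definition orthonormal_columns :: "real ^ 'n ^ 'm \<Rightarrow> bool" where
  "orthonormal_columns Q \<longleftrightarrow> transpose Q ** Q = mat 1"

text \<open>\<open>axis j 1\<close> is the canonical basis vector \<open>e\<^sub>j\<close>, and \<open>x v* Q\<close> is the row vector
  \<open>x\<^sup>T Q\<close>. Leverage scores and coherence are meant for matrices with orthonormal columns.\<close>

definition leverage_score :: "real ^ 'n ^ 'm \<Rightarrow> 'm \<Rightarrow> real" where
  "leverage_score Q j = (norm (axis j 1 v* Q))\<^sup>2"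

definition coherence :: "real ^ 'n ^ 'm \<Rightarrow> real" where
  "coherence Q = (MAX j. leverage_score Q j)"

end

theory Submission
  imports Defs
begin

text \<open>Start from a matrix whose rows are distinct basis vectors and zeros, so that its leverage
  scores are 0 or 1, and correct one score at a time by a plane rotation of two rows, which
  preserves orthonormality of the columns. By the intermediate value theorem a rotation moves one of
  the two scores to any value between them. To make every target reachable, keep all wrong scores
  but one, of index \<open>k\<close>, in \<open>{0, 1}\<close>. Since the scores and the targets have the same sum, if score
  \<open>k\<close> is too small then some other score is too large, hence equal to 1, and symmetrically with 0;
  rotating these two rows corrects score \<open>k\<close> and only the partner may leave \<open>{0, 1}\<close>.\<close>

lemma leverage_score_eq_row: "leverage_score Q j = (norm (Q $ j))\<^sup>2"
proof -
  have "axis j 1 v* Q = Q $ j"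
    by (simp add: vec_eq_iff vector_matrix_mult_def axis_def if_distrib if_distribR cong: if_cong)
  then show ?thesis
    by (simp add: leverage_score_def)
qed

lemma orthonormal_columns_iff:
  "orthonormal_columns Q \<longleftrightarrow>
     (\<forall>a b. (\<Sum>j\<in>UNIV. Q $ j $ a * Q $ j $ b) = (if a = b then 1 else 0))"
  by (simp add: orthonormal_columns_def vec_eq_iff matrix_matrix_mult_def transpose_def mat_def)

text \<open>Both sides equal the squared Frobenius norm of \<open>Q\<close>: summed by columns
  instead of rows, each unit column contributes 1.\<close>

lemma sum_leverage_score:
  fixes Q :: "real ^ 'n ^ 'm"
  assumes "orthonormal_columns Q"
  shows "(\<Sum>j\<in>UNIV. leverage_score Q j) = real CARD('n)"
proof -
  have "(\<Sum>j\<in>UNIV. leverage_score Q j) = (\<Sum>j\<in>UNIV. \<Sum>a\<in>UNIV. Q $ j $ a * Q $ j $ a)"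
    by (simp add: leverage_score_eq_row power2_norm_eq_inner inner_vec_def)
  also have "\<dots> = (\<Sum>a\<in>UNIV. \<Sum>j\<in>UNIV. Q $ j $ a * Q $ j $ a)"
    by (rule sum.swap)
  also have "\<dots> = real CARD('n)"
    using assms by (simp add: orthonormal_columns_iff)
  finally show ?thesis .
qed

text \<open>An injection \<open>f\<close> of column indices into row indices puts the basis vector
  of column \<open>a\<close> into row \<open>f a\<close>; the rows outside its range are
  zero.\<close>

lemma exists_zero_one_leverage_scores:
  assumes "CARD('n::finite) \<le> CARD('m::finite)"
  obtains Q :: "real ^ 'n ^ 'm"
  where "orthonormal_columns Q" and "\<And>j. leverage_score Q j \<in> {0, 1}"
proof -
  obtain f :: "'n \<Rightarrow> 'm" where f: "inj f"
    using assms card_le_inj[of "UNIV :: 'n set" "UNIV :: 'm set"] by auto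
  define Q :: "real ^ 'n ^ 'm" where "Q = (\<chi> j a. if f a = j then 1 else 0)"
  have "(\<Sum>j\<in>UNIV. Q $ j $ a * Q $ j $ b) = (if a = b then 1 else 0)" for a b
  proof -
    have "(\<Sum>j\<in>UNIV. Q $ j $ a * Q $ j $ b) = (\<Sum>j\<in>UNIV. if f a = j then (if f b = f a then 1 else 0) else 0)"
      by (rule sum.cong) (auto simp: Q_def)
    then show ?thesis
      using f by (auto simp: inj_eq)
  qed
  then have "orthonormal_columns Q"
    by (simp add: orthonormal_columns_iff)
  moreover have "leverage_score Q j \<in> {0, 1}" for j
  proof (cases "j \<in> range f")
    case True
    then obtain a where "j = f a" by blast
    then have "Q $ j = axis a 1"
      using f by (auto simp: Q_def vec_eq_iff axis_def inj_eq)
    then show ?thesis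
      by (simp add: leverage_score_eq_row)
  next
    case False
    then have "Q $ j = 0"
      by (auto simp: Q_def vec_eq_iff)
    then show ?thesis
      by (simp add: leverage_score_eq_row)
  qed
  ultimately show ?thesis
    using that by blast
qed

lemma rotate_rows:
  fixes Q :: "real ^ 'n ^ 'm"
  assumes Q: "orthonormal_columns Q" and "i \<noteq> j"
    and v: "leverage_score Q i \<le> v" "v \<le> leverage_score Q j"
  obtains Q' :: "real ^ 'n ^ 'm" where "orthonormal_columns Q'"
    and "leverage_score Q' i = v"
    and "leverage_score Q' j = leverage_score Q i + leverage_score Q j - v"
    and "\<And>k. k \<noteq> i \<Longrightarrow> k \<noteq> j \<Longrightarrow> leverage_score Q' k = leverage_score Q k"
proof -
  define f where "f t = (norm (cos t *\<^sub>R Q $ i + sin t *\<^sub>R Q $ j))\<^sup>2" for t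
  \<comment> \<open>At angle 0 the combined row is row \<open>i\<close>, at \<open>pi / 2\<close> it
    is row \<open>j\<close>, so \<open>v\<close> lies between the end values of
    \<open>f\<close>.\<close>
  have "\<exists>t\<ge>0. t \<le> pi / 2 \<and> f t = v"
  proof (rule IVT')
    show "continuous_on {0..pi / 2} f"
      unfolding f_def by (intro continuous_intros)
  qed (use v in \<open>auto simp: f_def leverage_score_eq_row\<close>)
  then obtain t where t: "f t = v" by blast
  define Q' :: "real ^ 'n ^ 'm" where "Q' = (\<chi> k.
    if k = i then cos t *\<^sub>R Q $ i + sin t *\<^sub>R Q $ j
    else if k = j then - sin t *\<^sub>R Q $ i + cos t *\<^sub>R Q $ j else Q $ k)"
  have split: "(\<Sum>k\<in>UNIV. h k) = h i + h j + (\<Sum>k\<in>UNIV - {i, j}. h k)" for h :: "'m \<Rightarrow> real"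
    using sum.subset_diff[of "{i, j}" UNIV h] \<open>i \<noteq> j\<close> by simp
  have cs: "(cos t)\<^sup>2 = 1 - (sin t)\<^sup>2"
    by (simp add: cos_squared_eq)
  \<comment> \<open>A rotation preserves inner products in the plane. Applied to the entries of two
    columns in rows \<open>i\<close> and \<open>j\<close>, this keeps the joint contribution of
    these rows to the Gram matrix.\<close>
  have rot: "(cos t * x + sin t * y) * (cos t * x' + sin t * y')
      + (cos t * y - sin t * x) * (cos t * y' - sin t * x') = x * x' + y * y'" for x x' y y'
    using cs by algebra
  have gram: "(\<Sum>k\<in>UNIV. Q' $ k $ a * Q' $ k $ b) = (\<Sum>k\<in>UNIV. Q $ k $ a * Q $ k $ b)" for a b
    using \<open>i \<noteq> j\<close> rot[of "Q $ i $ a" "Q $ j $ a" "Q $ i $ b" "Q $ j $ b"]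
    by (simp add: split Q'_def)
  then have Q': "orthonormal_columns Q'"
    using Q by (simp add: orthonormal_columns_iff)
  have i: "leverage_score Q' i = v"
    using t by (simp add: leverage_score_eq_row Q'_def f_def)
  have other: "leverage_score Q' k = leverage_score Q k" if "k \<noteq> i" "k \<noteq> j" for k
    using that by (simp add: leverage_score_eq_row Q'_def)
  \<comment> \<open>No computation with row \<open>j\<close> is needed: the total is the same for
    \<open>Q\<close> and \<open>Q'\<close>, and all other scores are known.\<close>
  have "leverage_score Q' j = leverage_score Q i + leverage_score Q j - v"
    using sum_leverage_score[OF Q] sum_leverage_score[OF Q'] i other by (simp add: split)
  with Q' i other show ?thesis
    using that by blast
qed

text \<open>Induction on the number of wrong scores. The exceptional index \<open>k\<close> varies
  with \<open>Q\<close>, since each rotation passes this role on to the partner row.\<close>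

lemma correct_leverage_scores:
  fixes Q :: "real ^ 'n ^ 'm" and l :: "'m \<Rightarrow> real"
  assumes "orthonormal_columns Q"
    and "\<And>j. j \<noteq> k \<Longrightarrow> leverage_score Q j \<in> {0, 1, l j}"
    and l: "\<And>j. 0 \<le> l j" "\<And>j. l j \<le> 1" "(\<Sum>j\<in>UNIV. l j) = real CARD('n)"
  shows "\<exists>Q' :: real ^ 'n ^ 'm. orthonormal_columns Q' \<and> (\<forall>j. leverage_score Q' j = l j)"
  using assms(1,2)
proof (induction "card {j. leverage_score Q j \<noteq> l j}" arbitrary: Q k rule: less_induct)
  case less
  note Q = less.prems(1) and inv = less.prems(2)
  have sums: "(\<Sum>j\<in>UNIV. leverage_score Q j) = (\<Sum>j\<in>UNIV. l j)"
    using sum_leverage_score[OF Q] l(3) by simp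
  show ?case
  proof (cases "\<forall>j. leverage_score Q j = l j")
    case True
    with Q show ?thesis by blast
  next
    case False
    \<comment> \<open>The row to correct is \<open>k\<close> if its score is wrong. Otherwise no
      score is exceptional and any wrong index serves.\<close>
    obtain p where p: "leverage_score Q p \<noteq> l p"
      and inv_p: "\<And>j. j \<noteq> p \<Longrightarrow> leverage_score Q j \<in> {0, 1, l j}"
    proof (cases "leverage_score Q k = l k")
      case True
      with inv have "leverage_score Q j \<in> {0, 1, l j}" for j
        by (cases "j = k") auto
      with False that show ?thesis by blast
    next
      case False
      with inv that show ?thesis by blast
    qed
    \<comment> \<open>The set of wrong indices loses \<open>p\<close> and gains nothing, because
      \<open>q\<close> was wrong already; \<open>q\<close> becomes the new exceptional
      index.\<close>
    have finish: ?thesis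
      if "orthonormal_columns R" "q \<noteq> p" "leverage_score R p = l p" "leverage_score Q q \<noteq> l q"
        "\<And>j. j \<noteq> p \<Longrightarrow> j \<noteq> q \<Longrightarrow> leverage_score R j = leverage_score Q j"
      for R :: "real ^ 'n ^ 'm" and q
    proof (rule less.hyps[of R q])
      have "{j. leverage_score R j \<noteq> l j} \<subset> {j. leverage_score Q j \<noteq> l j}"
      proof
        show "{j. leverage_score R j \<noteq> l j} \<subseteq> {j. leverage_score Q j \<noteq> l j}"
        proof clarify
          fix j assume "leverage_score R j \<noteq> l j" "leverage_score Q j = l j"
          with that p show False
            by (cases "j = p"; cases "j = q") auto
        qed
        show "{j. leverage_score R j \<noteq> l j} \<noteq> {j. leverage_score Q j \<noteq> l j}"
          using that(3) p by blast
      qed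
      then show "card {j. leverage_score R j \<noteq> l j} < card {j. leverage_score Q j \<noteq> l j}"
        by (intro psubset_card_mono) auto
      show "leverage_score R j \<in> {0, 1, l j}" if "j \<noteq> q" for j
        using that inv_p \<open>leverage_score R p = l p\<close>
          \<open>\<And>j. j \<noteq> p \<Longrightarrow> j \<noteq> q \<Longrightarrow> leverage_score R j = leverage_score Q j\<close>
        by (cases "j = p") auto
    qed fact
    consider "leverage_score Q p < l p" | "leverage_score Q p > l p"
      using p by linarith
    then show ?thesis
    proof cases
      case 1
      have "\<exists>q. l q < leverage_score Q q"
      proof (rule ccontr)
        assume "\<not> ?thesis"
        with 1 have "(\<Sum>j\<in>UNIV. leverage_score Q j) < (\<Sum>j\<in>UNIV. l j)"
          by (intro sum_strict_mono_ex1) (auto simp: not_less)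
        with sums show False by simp
      qed
      then obtain q where q: "l q < leverage_score Q q" by blast
      with 1 have "q \<noteq> p" by auto
      \<comment> \<open>A score above \<open>l q\<close>, which is nonnegative, is neither 0 nor
        \<open>l q\<close>.\<close>
      have "leverage_score Q q = 1"
        using inv_p[OF \<open>q \<noteq> p\<close>] q l(1)[of q] by auto
      then have "l p \<le> leverage_score Q q"
        using l(2) by simp
      show ?thesis
      proof (rule rotate_rows[OF Q \<open>q \<noteq> p\<close>[symmetric] less_imp_le[OF 1] \<open>l p \<le> leverage_score Q q\<close>])
        fix R :: "real ^ 'n ^ 'm"
        assume "orthonormal_columns R" "leverage_score R p = l p"
          "\<And>j. j \<noteq> p \<Longrightarrow> j \<noteq> q \<Longrightarrow> leverage_score R j = leverage_score Q j"
        with \<open>q \<noteq> p\<close> q show ?thesis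
          by (intro finish[of R q]) simp_all
      qed
    next
      case 2
      have "\<exists>q. leverage_score Q q < l q"
      proof (rule ccontr)
        assume "\<not> ?thesis"
        with 2 have "(\<Sum>j\<in>UNIV. l j) < (\<Sum>j\<in>UNIV. leverage_score Q j)"
          by (intro sum_strict_mono_ex1) (auto simp: not_less)
        with sums show False by simp
      qed
      then obtain q where q: "leverage_score Q q < l q" by blast
      with 2 have "q \<noteq> p" by auto
      have "leverage_score Q q = 0"
        using inv_p[OF \<open>q \<noteq> p\<close>] q l(2)[of q] by auto
      \<comment> \<open>\<open>rotate_rows\<close> prescribes the score of the row with the smaller
        score, here \<open>q\<close>. The value is chosen so that the remainder left to
        \<open>p\<close> is \<open>l p\<close>.\<close>
      then have "leverage_score Q q \<le> leverage_score Q q + leverage_score Q p - l p"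
        "leverage_score Q q + leverage_score Q p - l p \<le> leverage_score Q p"
        using 2 l(1)[of p] by auto
      then show ?thesis
      proof (rule rotate_rows[OF Q \<open>q \<noteq> p\<close>])
        fix R :: "real ^ 'n ^ 'm"
        assume "orthonormal_columns R"
          "leverage_score R p = leverage_score Q q + leverage_score Q p
            - (leverage_score Q q + leverage_score Q p - l p)"
          "\<And>j. j \<noteq> q \<Longrightarrow> j \<noteq> p \<Longrightarrow> leverage_score R j = leverage_score Q j"
        with \<open>q \<noteq> p\<close> q show ?thesis
          by (intro finish[of R q]) simp_all
      qed
    qed
  qed
qed

theorem theoremC2:
  fixes l :: "real ^ 'm"
  assumes "CARD('n::finite) \<le> CARD('m)"
    and "\<And>j. 0 \<le> l $ j" and "\<And>j. l $ j \<le> 1"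
    and "(\<Sum>j\<in>UNIV. l $ j) = real CARD('n)"
  shows "\<exists>Q :: real ^ 'n ^ 'm.
    orthonormal_columns Q \<and>
    (\<forall>j. leverage_score Q j = l $ j) \<and>
    coherence Q = (MAX j. l $ j)"
proof -
  obtain Q0 :: "real ^ 'n ^ 'm"
    where "orthonormal_columns Q0" "\<And>j. leverage_score Q0 j \<in> {0, 1}"
    using exists_zero_one_leverage_scores[OF assms(1)] by metis
  then obtain Q :: "real ^ 'n ^ 'm"
    where "orthonormal_columns Q" "\<forall>j. leverage_score Q j = l $ j"
    \<comment> \<open>Any index can play the exceptional one, as all scores of \<open>Q0\<close> are
      0 or 1.\<close>
    using correct_leverage_scores[of Q0 undefined "\<lambda>j. l $ j"] assms(2-4) by blast
  then show ?thesis
    by (auto simp: coherence_def)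
qed

end
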